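(* Let $(\mathcal{X},\tau,\mathcal{B})$ be an effective topological space such that the set of all Type-2 names of points of $\mathcal{X}$ is a $\Pi^0_2$ subset of Baire space $\mathbb{N}^{\mathbb{N}}$. For $A\subseteq X_c$, the following are equivalent: (a) there is a $\Sigma^0_2$ set $I\subseteq\mathbb{N}$ such that for every $x\in X_c$ and every Markov name $e$ of $x$, $x\in A$ iff $e\in I$; (b) there exist effective open sets $\mathcal{U}^n_k,\mathcal{V}^n_k\subseteq\mathcal{X}$, uniformly in $n,k\in\mathbb{N}$, such that for every $k$, $A\cap X_c(k)=\bigcup_n(\mathcal{U}^n_k\setminus\mathcal{V}^n_k)\cap X_c(k)$.
   Context: Let $(\varphi_e)$ be a standard enumeration of partial computable functions, $W_e=\mathrm{dom}(\varphi_e)$. An effective topological space is $(\mathcal{X},\tau,\mathcal{B})$ with $(\mathcal{X},\tau)$ a non-empty topological space and $\mathcal{B}=(\mathcal{B}_i)_{i}$ a numbered basis with a total computable $g$ such that $\mathcal{B}_i\cap\mathcal{B}_j=\bigcup_{k\in W_{g(i,j)}}\mathcal{B}_k$. A Type-2 name of $x$ is any $p\in\mathbb{N}^{\mathbb{N}}$ with $\{p(n)\}=\{i:x\in\mathcal{B}_i\}$; $X_c$ is the set of points having a computable Type-2 name. A Markov name of $x\in X_c$ is an $e$ such that $\varphi_e$ is total and a Type-2 name of $x$. $K(x)$ is the length of a shortest program computing a Type-2 name of $x$, and $X_c(k)=\{x\in X_c:K(x)\leq k\}$. An effective open set is one of the form $\bigcup_{i\in W_e}\mathcal{B}_i$;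 a family is uniformly effective open if the index $e$ is computable from the parameters. $\Sigma^0_2$ refers to the arithmetical hierarchy on $\mathbb{N}$ and $\Pi^0_2$ to the effective Borel hierarchy on Baire space. *)

theory Defs
  imports
    "HOL-Analysis.Abstract_Topology"
    "HOL-Library.Nat_Bijection"
    "HOL-Library.Discrete_Functions"
begin

section \<open>Partial computable functions\<close>

text \<open>Kleene's \<open>\<mu>\<close>-recursive functions. Arities are left implicit: an application to a list
  of unsuitable length is simply undefined. \<open>PrimRec f g\<close> recurses on the first argument;
  \<open>Mu f\<close> searches for the least first argument at which \<open>f\<close> vanishes, and requires \<open>f\<close> to be
  defined at all smaller ones.\<close>

datatype recf =
    Zero
  | Succ
  | Proj nat
  | Comp recf "recf list"
  | PrimRec recf recf
  | Mu recf

inductive rec_eval :: "recf \<Rightarrow> nat list \<Rightarrow> nat \<Rightarrow> bool" where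
  Zero: "rec_eval Zero xs 0"
| Succ: "rec_eval Succ [x] (Suc x)"
| Proj: "i < length xs \<Longrightarrow> rec_eval (Proj i) xs (xs ! i)"
| Comp: "length ys = length gs \<Longrightarrow> (\<forall>i<length gs. rec_eval (gs ! i) xs (ys ! i)) \<Longrightarrow>
    rec_eval f ys z \<Longrightarrow> rec_eval (Comp f gs) xs z"
| PrimRec_0: "rec_eval f xs y \<Longrightarrow> rec_eval (PrimRec f g) (0 # xs) y"
| PrimRec_Suc: "rec_eval (PrimRec f g) (n # xs) y \<Longrightarrow> rec_eval g (n # y # xs) z \<Longrightarrow>
    rec_eval (PrimRec f g) (Suc n # xs) z"
| Mu: "rec_eval f (n # xs) 0 \<Longrightarrow> (\<forall>m<n. \<exists>y. rec_eval f (m # xs) (Suc y)) \<Longrightarrow>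
    rec_eval (Mu f) xs n"

text \<open>An \<open>n\<close>-ary function is represented by a function on lists, of which only the values on
  lists of length \<open>n\<close> matter.\<close>

definition partial_computable :: "nat \<Rightarrow> (nat list \<Rightarrow> nat option) \<Rightarrow> bool" where
  "partial_computable n f \<longleftrightarrow>
     (\<exists>r. \<forall>xs. length xs = n \<longrightarrow> (\<forall>y. f xs = Some y \<longleftrightarrow> rec_eval r xs y))"

definition total_computable :: "nat \<Rightarrow> (nat list \<Rightarrow> nat) \<Rightarrow> bool" where
  "total_computable n f \<longleftrightarrow> partial_computable n (\<lambda>xs. Some (f xs))"

definition decidable_pred :: "nat \<Rightarrow> (nat list \<Rightarrow> bool) \<Rightarrow> bool" where
  "decidable_pred n R \<longleftrightarrow> total_computable n (\<lambda>xs. if R xs then 1 else 0)"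

text \<open>A standard enumeration of the unary partial computable functions is an acceptable
  numbering in the sense of Rogers: it has a partial computable universal function, and every
  partial computable sequence of functions factors computably through it. Applied to constant
  sequences, the second clause shows that every unary partial computable function is listed.\<close>

definition acceptable_numbering :: "(nat \<Rightarrow> nat \<Rightarrow> nat option) \<Rightarrow> bool" where
  "acceptable_numbering \<phi> \<longleftrightarrow>
     partial_computable 2 (\<lambda>xs. \<phi> (xs ! 0) (xs ! 1)) \<and>
     (\<forall>\<psi> :: nat \<Rightarrow> nat \<Rightarrow> nat option. partial_computable 2 (\<lambda>xs. \<psi> (xs ! 0) (xs ! 1)) \<longrightarrow>
        (\<exists>s. total_computable 1 (\<lambda>xs. s (xs ! 0)) \<and> (\<forall>i. \<phi> (s i) = \<psi> i)))"

definition W :: "(nat \<Rightarrow> nat \<Rightarrow> nat option) \<Rightarrow> nat \<Rightarrow> nat set" where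
  "W \<phi> e = dom (\<phi> e)"

definition Sigma02_nat :: "nat set \<Rightarrow> bool" where
  "Sigma02_nat I \<longleftrightarrow>
     (\<exists>R :: nat \<Rightarrow> nat \<Rightarrow> nat \<Rightarrow> bool. decidable_pred 3 (\<lambda>xs. R (xs ! 0) (xs ! 1) (xs ! 2)) \<and>
        I = {e. \<exists>a. \<forall>b. R e a b})"

section \<open>Effective topological spaces\<close>

definition effective_open :: "(nat \<Rightarrow> nat \<Rightarrow> nat option) \<Rightarrow> (nat \<Rightarrow> 'a set) \<Rightarrow> nat \<Rightarrow> 'a set" where
  "effective_open \<phi> B e = (\<Union>i\<in>W \<phi> e. B i)"

definition uniformly_effective_open ::
    "(nat \<Rightarrow> nat \<Rightarrow> nat option) \<Rightarrow> (nat \<Rightarrow> 'a set) \<Rightarrow> (nat \<Rightarrow> 'a set) \<Rightarrow> bool" where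
  "uniformly_effective_open \<phi> B U \<longleftrightarrow>
     (\<exists>h. total_computable 1 (\<lambda>xs. h (xs ! 0)) \<and> (\<forall>n. U n = effective_open \<phi> B (h n)))"

definition uniformly_effective_open2 ::
    "(nat \<Rightarrow> nat \<Rightarrow> nat option) \<Rightarrow> (nat \<Rightarrow> 'a set) \<Rightarrow> (nat \<Rightarrow> nat \<Rightarrow> 'a set) \<Rightarrow> bool" where
  "uniformly_effective_open2 \<phi> B U \<longleftrightarrow>
     (\<exists>h. total_computable 2 (\<lambda>xs. h (xs ! 0) (xs ! 1)) \<and>
          (\<forall>n k. U n k = effective_open \<phi> B (h n k)))"

definition effective_topological_space ::
    "(nat \<Rightarrow> nat \<Rightarrow> nat option) \<Rightarrow> 'a topology \<Rightarrow> (nat \<Rightarrow> 'a set) \<Rightarrow> bool" where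
  "effective_topological_space \<phi> X B \<longleftrightarrow>
     topspace X \<noteq> {} \<and>
     openin X = arbitrary union_of (\<lambda>U. U \<in> range B) \<and>
     (\<exists>g. total_computable 2 (\<lambda>xs. g (xs ! 0) (xs ! 1)) \<and>
          (\<forall>i j. B i \<inter> B j = (\<Union>k\<in>W \<phi> (g i j). B k)))"

text \<open>The basic open sets of Baire space, numbered through the standard bijection between
  natural numbers and finite sequences.\<close>

definition cylinder :: "nat \<Rightarrow> (nat \<Rightarrow> nat) set" where
  "cylinder i = {p. \<forall>j<length (list_decode i). p j = list_decode i ! j}"

definition Pi02_baire :: "(nat \<Rightarrow> nat \<Rightarrow> nat option) \<Rightarrow> (nat \<Rightarrow> nat) set \<Rightarrow> bool" where
  "Pi02_baire \<phi> S \<longleftrightarrow> (\<exists>G. uniformly_effective_open \<phi> cylinder G \<and> S = (\<Inter>n. G n))"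

section \<open>Names and complexity of points\<close>

definition type2_name :: "(nat \<Rightarrow> 'a set) \<Rightarrow> 'a \<Rightarrow> (nat \<Rightarrow> nat) \<Rightarrow> bool" where
  "type2_name B x p \<longleftrightarrow> range p = {i. x \<in> B i}"

definition type2_names :: "'a topology \<Rightarrow> (nat \<Rightarrow> 'a set) \<Rightarrow> (nat \<Rightarrow> nat) set" where
  "type2_names X B = {p. \<exists>x\<in>topspace X. type2_name B x p}"

definition computable_points :: "'a topology \<Rightarrow> (nat \<Rightarrow> 'a set) \<Rightarrow> 'a set" where
  "computable_points X B =
     {x \<in> topspace X. \<exists>p. total_computable 1 (\<lambda>xs. p (xs ! 0)) \<and> type2_name B x p}"

definition markov_name ::
    "(nat \<Rightarrow> nat \<Rightarrow> nat option) \<Rightarrow> (nat \<Rightarrow> 'a set) \<Rightarrow> 'a \<Rightarrow> nat \<Rightarrow> bool" where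
  "markov_name \<phi> B x e \<longleftrightarrow> (\<exists>p. (\<forall>n. \<phi> e n = Some (p n)) \<and> type2_name B x p)"

text \<open>The program with index \<open>e\<close> is the \<open>e\<close>-th binary word in length-lexicographic order,
  that is, the binary expansion of \<open>e + 1\<close> without its leading digit.\<close>

definition program_length :: "nat \<Rightarrow> nat" where
  "program_length e = floor_log (e + 1)"

definition point_complexity ::
    "(nat \<Rightarrow> nat \<Rightarrow> nat option) \<Rightarrow> (nat \<Rightarrow> 'a set) \<Rightarrow> 'a \<Rightarrow> nat" where
  "point_complexity \<phi> B x = (LEAST l. \<exists>e. markov_name \<phi> B x e \<and> program_length e = l)"

definition computable_points_upto ::
    "(nat \<Rightarrow> nat \<Rightarrow> nat option) \<Rightarrow> 'a topology \<Rightarrow> (nat \<Rightarrow> 'a set) \<Rightarrow> nat \<Rightarrow> 'a set" where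
  "computable_points_upto \<phi> X B k =
     {x \<in> computable_points X B. point_complexity \<phi> B x \<le> k}"

end

theory Submission
  imports Defs
begin

text \<open>From differences to \<open>\<Sigma>\<^sup>0\<^sub>2\<close>: a Markov name \<open>e\<close> of \<open>x\<close> bounds the complexity of \<open>x\<close>, so it
  selects a \<open>k\<close> for which membership in \<open>A\<close> is expressed by the given differences, and membership
  in an effective open set is semidecidable from \<open>e\<close>.

  From \<open>\<Sigma>\<^sup>0\<^sub>2\<close> to differences: a point \<open>x\<close> of complexity at most \<open>k\<close> has a Markov name among the
  finitely many \<open>e < 2 ^ (k + 1)\<close>, so \<open>x \<in> A\<close> iff for each of these either \<open>e\<close> is not a name of \<open>x\<close>
  or \<open>e \<in> I\<close>. This has one of four causes: \<open>\<phi> e\<close> is undefined at some \<open>d\<close>; \<open>x \<notin> B (\<phi> e d)\<close> for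
  some \<open>d\<close>; \<open>x \<in> B i\<close> for some \<open>i\<close> not listed by \<open>\<phi> e\<close>; or some witness \<open>d\<close> puts \<open>e\<close> into \<open>I\<close>. The
  index \<open>n\<close> guesses a cause for every \<open>e\<close>. The positive condition \<open>x \<in> B i\<close> goes into \<open>U n k\<close>, and
  each of the remaining conditions is refuted by an effective open event, which goes into \<open>V n k\<close>.\<close>

section \<open>Closure properties of the total computable functions\<close>

lemma rec_eval_deterministic: "rec_eval r xs y \<Longrightarrow> rec_eval r xs z \<Longrightarrow> y = z"
proof (induction arbitrary: z rule: rec_eval.induct)
  case (Comp ys gs xs f w)
  from Comp.prems obtain ys' where ys': "length ys' = length gs"
    "\<forall>i<length gs. rec_eval (gs ! i) xs (ys' ! i)" "rec_eval f ys' z"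
    by (cases rule: rec_eval.cases) auto
  have "ys = ys'"
    using Comp.hyps Comp.IH ys' by (intro nth_equalityI) auto
  then show ?case using Comp.IH ys' by auto
next
  case (PrimRec_0 f xs y g)
  from PrimRec_0.prems show ?case
    by (cases rule: rec_eval.cases) (auto intro: PrimRec_0.IH)
next
  case (PrimRec_Suc f g n xs y w)
  from PrimRec_Suc.prems obtain y' where
    "rec_eval (PrimRec f g) (n # xs) y'" "rec_eval g (n # y' # xs) z"
    by (cases rule: rec_eval.cases) auto
  then show ?case using PrimRec_Suc.IH by blast
next
  case (Mu f n xs)
  from Mu.prems have z: "rec_eval f (z # xs) 0" "\<forall>m<z. \<exists>y. rec_eval f (m # xs) (Suc y)"
    by (cases rule: rec_eval.cases; auto)+
  show ?case
  proof (cases n z rule: linorder_cases)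
    case less
    then show ?thesis using z(2) Mu.IH by blast
  next
    case greater
    then show ?thesis using z(1) Mu.IH by blast
  qed
qed (auto elim: rec_eval.cases)

text \<open>Determinism supplies the other half of \<open>partial_computable\<close>: once
  \<open>r\<close> yields \<open>f xs\<close>, it yields nothing else.\<close>

lemma total_computable_iff:
  "total_computable n f \<longleftrightarrow> (\<exists>r. \<forall>xs. length xs = n \<longrightarrow> rec_eval r xs (f xs))"
  unfolding total_computable_def partial_computable_def
  by (metis option.inject rec_eval_deterministic)

lemma total_computable_cong:
  assumes "total_computable n f" "\<And>xs. length xs = n \<Longrightarrow> f xs = g xs"
  shows "total_computable n g"
  using assms unfolding total_computable_iff by metis

text \<open>Composition needs one computable function per component, and a fixed length, because the
  outer function is only controlled on lists of its own arity.\<close>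

definition computable_map :: "nat \<Rightarrow> nat \<Rightarrow> (nat list \<Rightarrow> nat list) \<Rightarrow> bool" where
  "computable_map n m G \<longleftrightarrow> (\<forall>xs. length xs = n \<longrightarrow> length (G xs) = m) \<and>
     (\<forall>i<m. total_computable n (\<lambda>xs. G xs ! i))"

lemma total_computable_proj: "i < n \<Longrightarrow> total_computable n (\<lambda>xs. xs ! i)"
  unfolding total_computable_iff by (intro exI[of _ "Proj i"]) (auto intro: rec_eval.Proj)

lemma total_computable_comp:
  assumes "total_computable m F" "computable_map n m G"
  shows "total_computable n (\<lambda>xs. F (G xs))"
proof -
  obtain rF where rF: "\<And>xs. length xs = m \<Longrightarrow> rec_eval rF xs (F xs)"
    using assms(1) unfolding total_computable_iff by blast
  obtain r where r: "\<And>i xs. i < m \<Longrightarrow> length xs = n \<Longrightarrow> rec_eval (r i) xs (G xs ! i)"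
    using assms(2) unfolding computable_map_def total_computable_iff by metis
  have "rec_eval (Comp rF (map r [0..<m])) xs (F (G xs))" if "length xs = n" for xs
    using that rF r assms(2)
    by (intro rec_eval.Comp[where ys = "G xs"]) (auto simp: computable_map_def)
  then show ?thesis unfolding total_computable_iff by blast
qed

lemma computable_map_id: "computable_map n n (\<lambda>xs. xs)"
  by (auto simp: computable_map_def intro: total_computable_proj)

lemma computable_map_Nil: "computable_map n 0 (\<lambda>xs. [])"
  by (auto simp: computable_map_def)

lemma computable_map_Cons:
  assumes "total_computable n f" "computable_map n m G"
  shows "computable_map n (Suc m) (\<lambda>xs. f xs # G xs)"
  unfolding computable_map_def
proof (intro conjI allI impI)
  fix i assume "i < Suc m"
  then show "total_computable n (\<lambda>xs. (f xs # G xs) ! i)"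
    using assms by (cases i) (auto simp: computable_map_def)
qed (use assms in \<open>auto simp: computable_map_def\<close>)

lemma computable_map_map:
  assumes "\<And>g. g \<in> set gs \<Longrightarrow> total_computable n (F g)"
  shows "computable_map n (length gs) (\<lambda>xs. map (\<lambda>g. F g xs) gs)"
  using assms by (auto simp: computable_map_def)

lemma computable_map_tl:
  assumes "computable_map n (Suc m) G"
  shows "computable_map n m (\<lambda>xs. tl (G xs))"
  unfolding computable_map_def
proof (intro conjI allI impI)
  fix i assume "i < m"
  then have "total_computable n (\<lambda>xs. G xs ! Suc i)"
    using assms by (simp add: computable_map_def)
  then show "total_computable n (\<lambda>xs. tl (G xs) ! i)"
    by (rule total_computable_cong) (use assms \<open>i < m\<close> in \<open>auto simp: computable_map_def nth_tl\<close>)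
qed (use assms in \<open>auto simp: computable_map_def\<close>)

lemmas computable_map_intros = computable_map_id computable_map_Nil computable_map_Cons
  computable_map_tl

named_theorems computable

text \<open>Bound variables go to the front of the argument list: one for a bounded quantifier or a
  search, two for a recursion. The tails reach the parameters below such binders.\<close>

lemma total_computable_nth [computable]:
  "i < n \<Longrightarrow> total_computable n (\<lambda>xs. xs ! i)"
  "Suc i < n \<Longrightarrow> total_computable n (\<lambda>xs. tl xs ! i)"
  "Suc (Suc i) < n \<Longrightarrow> total_computable n (\<lambda>xs. tl (tl xs) ! i)"
proof -
  show "total_computable n (\<lambda>xs. xs ! i)" if "i < n" using that by (rule total_computable_proj)
  show "total_computable n (\<lambda>xs. tl xs ! i)" if "Suc i < n"
    by (rule total_computable_cong, rule total_computable_proj[OF that]) (use that in \<open>simp add: nth_tl\<close>)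
  show "total_computable n (\<lambda>xs. tl (tl xs) ! i)" if "Suc (Suc i) < n"
    by (rule total_computable_cong, rule total_computable_proj[OF that]) (use that in \<open>simp add: nth_tl\<close>)
qed

lemma total_computable_comp1:
  assumes "total_computable 1 (\<lambda>xs. F (xs ! 0))" "total_computable n f"
  shows "total_computable n (\<lambda>xs. F (f xs))"
  using total_computable_comp[OF assms(1), of n "\<lambda>xs. [f xs]"] assms(2)
  by (simp add: computable_map_intros)

lemma total_computable_comp2:
  assumes "total_computable 2 (\<lambda>xs. F (xs ! 0) (xs ! 1))"
    "total_computable n f" "total_computable n g"
  shows "total_computable n (\<lambda>xs. F (f xs) (g xs))"
  using total_computable_comp[OF assms(1), of n "\<lambda>xs. [f xs, g xs]"] assms(2-)
  by (simp add: computable_map_intros numeral_2_eq_2)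

lemma total_computable_comp3:
  assumes "total_computable 3 (\<lambda>xs. F (xs ! 0) (xs ! 1) (xs ! 2))"
    "total_computable n f" "total_computable n g" "total_computable n h"
  shows "total_computable n (\<lambda>xs. F (f xs) (g xs) (h xs))"
  using total_computable_comp[OF assms(1), of n "\<lambda>xs. [f xs, g xs, h xs]"] assms(2-)
  by (simp add: computable_map_intros numeral_3_eq_3 numeral_2_eq_2)

lemma total_computable_Suc [computable]:
  assumes "total_computable n f"
  shows "total_computable n (\<lambda>xs. Suc (f xs))"
proof (rule total_computable_comp1[OF _ assms])
  have "rec_eval Succ xs (Suc (xs ! 0))" if "length xs = 1" for xs
    using that by (cases xs) (auto intro: rec_eval.Succ)
  then show "total_computable 1 (\<lambda>xs. Suc (xs ! 0))"
    unfolding total_computable_iff by blast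
qed

lemma total_computable_const [computable]: "total_computable n (\<lambda>xs. c)"
proof (induction c)
  case 0
  then show ?case unfolding total_computable_iff by (blast intro: rec_eval.Zero)
qed (rule total_computable_Suc)

text \<open>\<open>PrimRec\<close> realises the recursion on the list \<open>m # xs\<close>;
  composing with \<open>t xs # xs\<close> then substitutes the bound.\<close>

lemma total_computable_rec_nat [computable]:
  assumes "total_computable n a"
    and "total_computable (Suc (Suc n)) (\<lambda>xs. b (xs ! 0) (xs ! 1) (tl (tl xs)))"
    and "total_computable n t"
  shows "total_computable n (\<lambda>xs. rec_nat (a xs) (\<lambda>m v. b m v xs) (t xs))"
proof -
  obtain ra where ra: "\<And>xs. length xs = n \<Longrightarrow> rec_eval ra xs (a xs)"
    using assms(1) unfolding total_computable_iff by blast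
  obtain rb where rb: "\<And>xs. length xs = Suc (Suc n) \<Longrightarrow>
      rec_eval rb xs (b (xs ! 0) (xs ! 1) (tl (tl xs)))"
    using assms(2) unfolding total_computable_iff by blast
  have rec: "rec_eval (PrimRec ra rb) (m # xs) (rec_nat (a xs) (\<lambda>m v. b m v xs) m)"
    if "length xs = n" for m xs
  proof (induction m)
    case 0
    then show ?case by (simp add: rec_eval.PrimRec_0 ra that)
  next
    case (Suc m)
    with rb[of "m # rec_nat (a xs) (\<lambda>m v. b m v xs) m # xs"] show ?case
      by (auto intro!: rec_eval.PrimRec_Suc simp: that)
  qed
  have "total_computable (Suc n) (\<lambda>xs. rec_nat (a (tl xs)) (\<lambda>m v. b m v (tl xs)) (xs ! 0))"
    unfolding total_computable_iff
    by (intro exI[of _ "PrimRec ra rb"]) (auto simp: length_Suc_conv rec)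
  from total_computable_comp[OF this computable_map_Cons[OF assms(3) computable_map_id]]
  show ?thesis by simp
qed

section \<open>Decidable predicates, case distinction and arithmetic\<close>

lemma decidable_pred_cong:
  assumes "decidable_pred n P" "\<And>xs. length xs = n \<Longrightarrow> P xs \<longleftrightarrow> Q xs"
  shows "decidable_pred n Q"
  using assms(1) unfolding decidable_pred_def
  by (rule total_computable_cong) (simp add: assms(2))

lemma total_computable_if [computable]:
  assumes "decidable_pred n P" "total_computable n f" "total_computable n g"
  shows "total_computable n (\<lambda>xs. if P xs then f xs else g xs)"
proof -
  have f: "total_computable (Suc (Suc n)) (\<lambda>xs. f (tl (tl xs)))"
    by (intro total_computable_comp[OF assms(2)] computable_map_intros)
  \<comment> \<open>The characteristic function is the recursion bound: zero rounds leave
    \<open>g xs\<close>, one round replaces it by \<open>f xs\<close>.\<close>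
  have "total_computable n (\<lambda>xs. rec_nat (g xs) (\<lambda>_ _. f xs) (if P xs then 1 else 0))"
    by (intro total_computable_rec_nat[OF assms(3)] f assms(1)[unfolded decidable_pred_def])
  then show ?thesis by (rule total_computable_cong) simp
qed

lemma decidable_pred_const [computable]: "decidable_pred n (\<lambda>xs. c)"
  unfolding decidable_pred_def by (rule total_computable_const)

lemma decidable_pred_not [computable]:
  "decidable_pred n P \<Longrightarrow> decidable_pred n (\<lambda>xs. \<not> P xs)"
  using total_computable_if[OF _ total_computable_const[of n 0] total_computable_const[of n 1], of P]
  unfolding decidable_pred_def by (rule total_computable_cong) auto

lemma decidable_pred_if [computable]:
  assumes "decidable_pred n P" "decidable_pred n Q" "decidable_pred n R"
  shows "decidable_pred n (\<lambda>xs. if P xs then Q xs else R xs)"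
  using total_computable_if[OF assms(1) assms(2,3)[unfolded decidable_pred_def]]
  unfolding decidable_pred_def by (rule total_computable_cong) simp

lemma decidable_pred_conj [computable]:
  "decidable_pred n P \<Longrightarrow> decidable_pred n Q \<Longrightarrow> decidable_pred n (\<lambda>xs. P xs \<and> Q xs)"
  by (rule decidable_pred_cong[OF decidable_pred_if[of n P Q, OF _ _ decidable_pred_const[of n False]]]) auto

lemma decidable_pred_disj [computable]:
  "decidable_pred n P \<Longrightarrow> decidable_pred n Q \<Longrightarrow> decidable_pred n (\<lambda>xs. P xs \<or> Q xs)"
  by (rule decidable_pred_cong[OF decidable_pred_if[of n P _ Q, OF _ decidable_pred_const[of n True]]]) auto

lemma decidable_pred_ball_list:
  assumes "\<And>g. g \<in> set gs \<Longrightarrow> decidable_pred n (P g)"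
  shows "decidable_pred n (\<lambda>xs. \<forall>g\<in>set gs. P g xs)"
  using assms
proof (induction gs)
  case (Cons g gs)
  then show ?case using decidable_pred_conj[of n "P g"] by simp
qed (simp add: decidable_pred_const)

lemma decidable_pred_eq_0:
  assumes "total_computable n f"
  shows "decidable_pred n (\<lambda>xs. f xs = 0)"
proof -
  have "total_computable n (\<lambda>xs. rec_nat 1 (\<lambda>_ _. 0) (f xs))"
    by (intro computable assms)
  moreover have "rec_nat 1 (\<lambda>_ _. 0) m = (if m = 0 then 1 else (0::nat))" for m
    by (cases m) auto
  ultimately show ?thesis unfolding decidable_pred_def by simp
qed

lemma total_computable_add [computable]:
  assumes "total_computable n f" "total_computable n g"
  shows "total_computable n (\<lambda>xs. f xs + g xs)"
proof (rule total_computable_comp2[OF _ assms])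
  have "rec_nat a (\<lambda>_ v. Suc v) b = a + b" for a b by (induction b) auto
  moreover have "total_computable 2 (\<lambda>xs. rec_nat (xs ! 0) (\<lambda>_ v. Suc v) (xs ! 1))"
    by (rule computable | simp)+
  ultimately show "total_computable 2 (\<lambda>xs. xs ! 0 + xs ! 1)" by simp
qed

lemma total_computable_diff [computable]:
  assumes "total_computable n f" "total_computable n g"
  shows "total_computable n (\<lambda>xs. f xs - g xs)"
proof (rule total_computable_comp2[OF _ assms])
  \<comment> \<open>The predecessor is a recursion that returns its counter; iterating it gives
    truncated subtraction.\<close>
  have pred: "rec_nat 0 (\<lambda>m _. m) b = b - 1" for b by (cases b) auto
  have "rec_nat a (\<lambda>_ v. rec_nat 0 (\<lambda>m _. m) v) b = a - b" for a b
    by (induction b) (auto simp: pred)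
  moreover have "total_computable 2 (\<lambda>xs. rec_nat (xs ! 0) (\<lambda>_ v. rec_nat 0 (\<lambda>m _. m) v) (xs ! 1))"
    by (rule computable | simp)+
  ultimately show "total_computable 2 (\<lambda>xs. xs ! 0 - xs ! 1)" by simp
qed

lemma decidable_pred_le [computable]:
  assumes "total_computable n f" "total_computable n g"
  shows "decidable_pred n (\<lambda>xs. f xs \<le> g xs)"
  using decidable_pred_eq_0[OF total_computable_diff[OF assms]] by simp

lemma decidable_pred_less [computable]:
  assumes "total_computable n f" "total_computable n g"
  shows "decidable_pred n (\<lambda>xs. f xs < g xs)"
  using decidable_pred_not[OF decidable_pred_le[OF assms(2,1)]] by (simp add: not_le)

lemma decidable_pred_eq [computable]:
  assumes "total_computable n f" "total_computable n g"
  shows "decidable_pred n (\<lambda>xs. f xs = g xs)"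
  using decidable_pred_conj[OF decidable_pred_le[OF assms] decidable_pred_le[OF assms(2,1)]]
  by (rule decidable_pred_cong) auto

section \<open>Unbounded search and bounded quantifiers\<close>

lemma rec_eval_Mu_Least:
  assumes "\<And>xs. length xs = Suc n \<Longrightarrow> rec_eval r xs (if P (xs ! 0) (tl xs) then 0 else 1)"
    and "length xs = n"
  shows "rec_eval (Mu r) xs y \<longleftrightarrow> (\<exists>y. P y xs) \<and> y = (LEAST y. P y xs)"
proof -
  have r: "rec_eval r (m # xs) (if P m xs then 0 else 1)" for m
    using assms(1)[of "m # xs"] assms(2) by simp
  have Mu: "rec_eval (Mu r) xs (LEAST y. P y xs)" if "\<exists>y. P y xs"
  proof (rule rec_eval.Mu)
    show "rec_eval r ((LEAST y. P y xs) # xs) 0"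
      using r[of "LEAST y. P y xs"] LeastI_ex[OF that] by simp
    show "\<forall>m<LEAST y. P y xs. \<exists>y. rec_eval r (m # xs) (Suc y)"
      using r not_less_Least by (metis One_nat_def)
  qed
  show ?thesis
  proof
    assume *: "rec_eval (Mu r) xs y"
    then have "rec_eval r (y # xs) 0" by (cases rule: rec_eval.cases) auto
    with r[of y] have "P y xs"
      by (metis rec_eval_deterministic zero_neq_one)
    then show "(\<exists>y. P y xs) \<and> y = (LEAST y. P y xs)"
      using * Mu rec_eval_deterministic by blast
  qed (use Mu in blast)
qed

lemma partial_computable_Least:
  assumes "decidable_pred (Suc n) (\<lambda>xs. P (xs ! 0) (tl xs))"
  shows "partial_computable n (\<lambda>xs. if \<exists>y. P y xs then Some (LEAST y. P y xs) else None)"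
proof -
  \<comment> \<open>Truth is coded by 0 here, opposite to \<open>decidable_pred\<close>, because
    \<open>Mu\<close> searches for a zero.\<close>
  have "total_computable (Suc n) (\<lambda>xs. if P (xs ! 0) (tl xs) then 0 else 1)"
    by (intro computable assms)
  then obtain r where "\<And>xs. length xs = Suc n \<Longrightarrow>
      rec_eval r xs (if P (xs ! 0) (tl xs) then 0 else 1)"
    unfolding total_computable_iff by blast
  from rec_eval_Mu_Least[OF this] show ?thesis
    unfolding partial_computable_def by (intro exI[of _ "Mu r"]) auto
qed

lemma total_computable_Least:
  assumes "decidable_pred (Suc n) (\<lambda>xs. P (xs ! 0) (tl xs))"
    and "\<And>xs. length xs = n \<Longrightarrow> \<exists>y. P y xs"
  shows "total_computable n (\<lambda>xs. LEAST y. P y xs)"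
  using partial_computable_Least[OF assms(1)] assms(2)
  unfolding total_computable_def partial_computable_def by simp

text \<open>Search for the first counterexample, stopping at the bound at the latest. Admitting the
  bound keeps the search total, and reaching it means that no counterexample exists.\<close>

lemma decidable_pred_all_less [computable]:
  assumes "decidable_pred (Suc n) (\<lambda>xs. P (xs ! 0) (tl xs))" "total_computable n t"
  shows "decidable_pred n (\<lambda>xs. \<forall>y<t xs. P y xs)"
proof -
  have t: "total_computable (Suc n) (\<lambda>xs. t (tl xs))"
    by (intro total_computable_comp[OF assms(2)] computable_map_intros)
  have "decidable_pred (Suc n) (\<lambda>xs. xs ! 0 = t (tl xs) \<or> \<not> P (xs ! 0) (tl xs))"
    by (intro computable t assms(1)) simp
  then have "total_computable n (\<lambda>xs. LEAST y. y = t xs \<or> \<not> P y xs)"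
    by (rule total_computable_Least) blast
  then have "decidable_pred n (\<lambda>xs. (LEAST y. y = t xs \<or> \<not> P y xs) = t xs)"
    by (intro computable assms(2))
  moreover have "(LEAST y. y = t xs \<or> \<not> P y xs) = t xs \<longleftrightarrow> (\<forall>y<t xs. P y xs)" for xs
  proof
    assume "(LEAST y. y = t xs \<or> \<not> P y xs) = t xs"
    then show "\<forall>y<t xs. P y xs" by (metis (mono_tags, lifting) not_less_Least)
  next
    assume "\<forall>y<t xs. P y xs"
    then show "(LEAST y. y = t xs \<or> \<not> P y xs) = t xs"
      by (intro Least_equality) (auto simp: not_le[symmetric])
  qed
  ultimately show ?thesis by simp
qed

lemma decidable_pred_ex_less [computable]:
  assumes "decidable_pred (Suc n) (\<lambda>xs. P (xs ! 0) (tl xs))" "total_computable n t"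
  shows "decidable_pred n (\<lambda>xs. \<exists>y<t xs. P y xs)"
  using decidable_pred_not[OF decidable_pred_all_less[OF decidable_pred_not[OF assms(1)] assms(2)]]
  by simp

section \<open>Stage approximations of partial computable functions\<close>

text \<open>\<open>T (s # xs)\<close> is \<open>0\<close> if \<open>r\<close> has not converged on \<open>xs\<close> by stage \<open>s\<close>, and the successor of the
  value otherwise. Such a \<open>T\<close> exists for each single \<open>r\<close> by structural induction; no universal
  machine is needed, as \<open>r\<close> can be the universal function of an acceptable numbering.\<close>

definition stages :: "nat \<Rightarrow> recf \<Rightarrow> (nat list \<Rightarrow> nat) \<Rightarrow> bool" where
  "stages n r T \<longleftrightarrow> total_computable (Suc n) T \<and>
     (\<forall>xs y s s'. length xs = n \<longrightarrow> T (s # xs) = Suc y \<longrightarrow> s \<le> s' \<longrightarrow> T (s' # xs) = Suc y) \<and>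
     (\<forall>xs y. length xs = n \<longrightarrow> (rec_eval r xs y \<longleftrightarrow> (\<exists>s. T (s # xs) = Suc y)))"

lemma stagesI:
  assumes "total_computable (Suc n) T"
    and "\<And>xs y s s'. \<lbrakk>length xs = n; T (s # xs) = Suc y; s \<le> s'\<rbrakk> \<Longrightarrow> T (s' # xs) = Suc y"
    and "\<And>xs y. \<lbrakk>length xs = n; rec_eval r xs y\<rbrakk> \<Longrightarrow> \<exists>s. T (s # xs) = Suc y"
    and "\<And>xs y s. \<lbrakk>length xs = n; T (s # xs) = Suc y\<rbrakk> \<Longrightarrow> rec_eval r xs y"
  shows "stages n r T"
  using assms unfolding stages_def by blast

lemma stagesD:
  assumes "stages n r T"
  shows "total_computable (Suc n) T"
    and "\<lbrakk>T (s # xs) = Suc y; s \<le> s'; length xs = n\<rbrakk> \<Longrightarrow> T (s' # xs) = Suc y"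
    and "\<lbrakk>rec_eval r xs y; length xs = n\<rbrakk> \<Longrightarrow> \<exists>s. T (s # xs) = Suc y"
    and "\<lbrakk>T (s # xs) = Suc y; length xs = n\<rbrakk> \<Longrightarrow> rec_eval r xs y"
  using assms unfolding stages_def by blast+

text \<open>Persistence allows finitely many stages to be replaced by their maximum, so that several
  subcomputations converge at one stage.\<close>

lemma common_stage:
  fixes P :: "nat \<Rightarrow> nat \<Rightarrow> bool"
  assumes "\<And>i s s'. i < m \<Longrightarrow> P i s \<Longrightarrow> s \<le> s' \<Longrightarrow> P i s'" and "\<And>i. i < m \<Longrightarrow> \<exists>s. P i s"
  shows "\<exists>s. \<forall>i<m. P i s"
  using assms
proof (induction m)
  case (Suc m)
  then obtain s s' where "\<forall>i<m. P i s" "P m s'" by (metis less_Suc_eq)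
  then have "\<forall>i<Suc m. P i (max s s')"
    using Suc.prems(1) by (metis less_Suc_eq max.cobounded1 max.cobounded2)
  then show ?case by blast
qed simp

section \<open>Stage functions for the individual recursion schemes\<close>

lemma stages_undefined:
  assumes "\<And>xs y. length xs = n \<Longrightarrow> \<not> rec_eval r xs y"
  shows "stages n r (\<lambda>_. 0)"
  using assms by (intro stagesI computable) auto

lemma stages_total:
  assumes "total_computable n f" "\<And>xs. length xs = n \<Longrightarrow> rec_eval r xs (f xs)"
  shows "stages n r (\<lambda>xs. Suc (f (tl xs)))"
proof (rule stagesI)
  show "total_computable (Suc n) (\<lambda>xs. Suc (f (tl xs)))"
    by (intro computable total_computable_comp[OF assms(1)] computable_map_intros)
qed (use assms(2) in \<open>auto dest: rec_eval_deterministic\<close>)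

text \<open>All subcomputations run at the same stage. An argument with stage value 0 has not
  converged yet; nonzero stage values are decremented before they are passed to
  \<open>F\<close>.\<close>

lemma stages_Comp:
  assumes F: "stages (length gs) f F" and G: "\<And>g. g \<in> set gs \<Longrightarrow> stages n g (G g)"
  shows "\<exists>T. stages n (Comp f gs) T"
proof -
  define T where "T = (\<lambda>xs. if \<forall>g\<in>set gs. G g xs \<noteq> 0
    then F (xs ! 0 # map (\<lambda>g. G g xs - 1) gs) else 0)"
  have T: "T (s # xs) = Suc y \<longleftrightarrow>
      (\<exists>ys. length ys = length gs \<and> (\<forall>i<length gs. G (gs ! i) (s # xs) = Suc (ys ! i)) \<and>
        F (s # ys) = Suc y)" (is "_ \<longleftrightarrow> ?R") for s xs y
  proof
    assume "T (s # xs) = Suc y"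
    then show ?R
      by (intro exI[of _ "map (\<lambda>g. G g (s # xs) - 1) gs"]) (auto simp: T_def split: if_splits)
  next
    assume ?R
    then obtain ys where ys: "length ys = length gs"
      "\<forall>i<length gs. G (gs ! i) (s # xs) = Suc (ys ! i)" "F (s # ys) = Suc y" by blast
    then have "map (\<lambda>g. G g (s # xs) - 1) gs = ys" by (intro nth_equalityI) auto
    moreover have "\<forall>g\<in>set gs. G g (s # xs) \<noteq> 0" using ys(2) by (auto simp: in_set_conv_nth)
    ultimately show "T (s # xs) = Suc y" using ys(3) by (simp add: T_def)
  qed
  have "stages n (Comp f gs) T"
  proof (rule stagesI)
    show "total_computable (Suc n) T"
      unfolding T_def
      by (intro computable decidable_pred_ball_list total_computable_comp[OF stagesD(1)[OF F]]
          computable_map_Cons computable_map_map stagesD(1)[OF G]) simp_all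
  next
    fix xs y s s' assume "length xs = n" "T (s # xs) = Suc y" "s \<le> s'"
    then show "T (s' # xs) = Suc y"
      unfolding T using stagesD(2)[OF F] stagesD(2)[OF G] by (metis nth_mem)
  next
    fix xs y assume len: "length xs = n" and eval: "rec_eval (Comp f gs) xs y"
    from eval obtain ys where ys: "length ys = length gs"
      "\<forall>i<length gs. rec_eval (gs ! i) xs (ys ! i)" "rec_eval f ys y"
      by (cases rule: rec_eval.cases) auto
    have "\<exists>s. \<forall>i<length gs. G (gs ! i) (s # xs) = Suc (ys ! i)"
    proof (rule common_stage)
      show "\<exists>s. G (gs ! i) (s # xs) = Suc (ys ! i)" if "i < length gs" for i
        using stagesD(3)[OF G[of "gs ! i"] _ len] ys(2) that by simp
    qed (rule stagesD(2)[OF G _ _ len], simp_all)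
    then obtain s where s: "\<forall>i<length gs. G (gs ! i) (s # xs) = Suc (ys ! i)" by blast
    obtain s' where s': "F (s' # ys) = Suc y" using stagesD(3)[OF F] ys by blast
    have "T (max s s' # xs) = Suc y"
      unfolding T
    proof (intro exI[of _ ys] conjI allI impI)
      show "F (max s s' # ys) = Suc y" using stagesD(2)[OF F s'] ys(1) by simp
      show "G (gs ! i) (max s s' # xs) = Suc (ys ! i)" if "i < length gs" for i
        using stagesD(2)[OF G[of "gs ! i"] _ _ len, of s] s that by simp
    qed (rule ys(1))
    then show "\<exists>s. T (s # xs) = Suc y" by blast
  next
    fix xs y s assume len: "length xs = n" and "T (s # xs) = Suc y"
    then obtain ys where ys: "length ys = length gs"
      "\<forall>i<length gs. G (gs ! i) (s # xs) = Suc (ys ! i)" "F (s # ys) = Suc y"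
      unfolding T by blast
    then show "rec_eval (Comp f gs) xs y"
      using stagesD(4)[OF F ys(3)] stagesD(4)[OF G _ len] by (intro rec_eval.Comp[of ys]) auto
  qed
  then show ?thesis by blast
qed

lemma stages_PrimRec:
  assumes F: "stages n f F" and G: "stages (Suc (Suc n)) g G"
  shows "\<exists>T. stages (Suc n) (PrimRec f g) T"
proof -
  \<comment> \<open>\<open>R s xs m\<close> is the recursion run entirely at stage \<open>s\<close>:
    0 means unfinished and is propagated, otherwise the previous value is
    \<open>v - 1\<close>.\<close>
  define R where "R s xs = rec_nat (F (s # xs)) (\<lambda>m v. if v = 0 then 0 else G (s # m # (v - 1) # xs))"
    for s xs
  have R_0 [simp]: "R s xs 0 = F (s # xs)" for s xs by (simp add: R_def)
  have R_Suc [simp]: "R s xs (Suc m) = (if R s xs m = 0 then 0 else G (s # m # (R s xs m - 1) # xs))"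
    for s xs m by (simp add: R_def)
  have mono: "R s' xs m = Suc y" if "R s xs m = Suc y" "s \<le> s'" "length xs = n" for s s' xs m y
    using that
  proof (induction m arbitrary: y)
    case (Suc m)
    then obtain z where z: "R s xs m = Suc z" by (cases "R s xs m") auto
    then have "G (s # m # z # xs) = Suc y" using Suc.prems by simp
    from stagesD(2)[OF G this Suc.prems(2)] Suc.IH[OF z] show ?case using Suc.prems(2,3) by simp
  qed (auto intro: stagesD(2)[OF F])
  define T where "T xs = R (xs ! 0) (tl (tl xs)) (xs ! 1)" for xs
  have T [simp]: "T (s # m # xs) = R s xs m" for s m xs by (simp add: T_def)
  have "stages (Suc n) (PrimRec f g) T"
  proof (rule stagesI)
    show "total_computable (Suc (Suc n)) T"
      unfolding T_def R_def
      by (intro computable total_computable_comp[OF stagesD(1)[OF F]]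
          total_computable_comp[OF stagesD(1)[OF G]] computable_map_intros) auto
  next
    fix xs y s s' assume "length xs = Suc n" "T (s # xs) = Suc y" "s \<le> s'"
    then show "T (s' # xs) = Suc y" by (auto simp: length_Suc_conv intro: mono)
  next
    fix xs y assume "length xs = Suc n" "rec_eval (PrimRec f g) xs y"
    moreover have "\<exists>s. R s xs m = Suc y"
      if "rec_eval (PrimRec f g) (m # xs) y" and len: "length xs = n" for m xs y
      using that(1)
    proof (induction m arbitrary: y)
      case 0
      then have "rec_eval f xs y" by (cases rule: rec_eval.cases) auto
      then show ?case using stagesD(3)[OF F _ len] by simp
    next
      case (Suc m)
      from Suc.prems obtain z where z: "rec_eval (PrimRec f g) (m # xs) z"
        "rec_eval g (m # z # xs) y" by (cases rule: rec_eval.cases) auto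
      obtain s where s: "R s xs m = Suc z" using Suc.IH z(1) by blast
      obtain s' where s': "G (s' # m # z # xs) = Suc y" using stagesD(3)[OF G z(2)] len by auto
      have "R (max s s') xs m = Suc z" using mono[OF s _ len] by simp
      moreover have "G (max s s' # m # z # xs) = Suc y" using stagesD(2)[OF G s'] len by simp
      ultimately show ?case by (intro exI[of _ "max s s'"]) simp
    qed
    ultimately show "\<exists>s. T (s # xs) = Suc y" by (auto simp: length_Suc_conv)
  next
    fix xs y s assume "length xs = Suc n" "T (s # xs) = Suc y"
    moreover have "rec_eval (PrimRec f g) (m # xs) y"
      if "R s xs m = Suc y" and len: "length xs = n" for m xs y
      using that(1)
    proof (induction m arbitrary: y)
      case 0
      then show ?case using stagesD(4)[OF F _ len] by (auto intro: rec_eval.PrimRec_0)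
    next
      case (Suc m)
      then obtain z where z: "R s xs m = Suc z" by (cases "R s xs m") auto
      then have "G (s # m # z # xs) = Suc y" using Suc.prems by simp
      then show ?case using Suc.IH[OF z] stagesD(4)[OF G] len by (auto intro: rec_eval.PrimRec_Suc)
    qed
    ultimately show "rec_eval (PrimRec f g) xs y" by (auto simp: length_Suc_conv)
  qed
  then show ?thesis by blast
qed

lemma stages_Mu:
  assumes F: "stages (Suc n) f F"
  shows "\<exists>T. stages n (Mu f) T"
proof -
  \<comment> \<open>The scan halts at the stage bound or at the first \<open>m\<close> where
    \<open>F\<close> is at most 1. There 0 means that \<open>f\<close> is still undecided and 1 that
    \<open>f\<close> has value zero; only the latter yields a minimum.\<close>
  define L where "L xs = (LEAST m. m = xs ! 0 \<or> F (xs ! 0 # m # tl xs) \<le> 1)" for xs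
  define T where "T xs = (if L xs < xs ! 0 \<and> F (xs ! 0 # L xs # tl xs) = 1 then Suc (L xs) else 0)"
    for xs
  have T: "T (s # xs) = Suc m \<longleftrightarrow>
      m < s \<and> F (s # m # xs) = 1 \<and> (\<forall>i<m. \<exists>y. F (s # i # xs) = Suc (Suc y))" for s xs m
  proof -
    let ?P = "\<lambda>m. m = s \<or> F (s # m # xs) \<le> 1"
    have big: "\<not> F (s # i # xs) \<le> 1 \<longleftrightarrow> (\<exists>y. F (s # i # xs) = Suc (Suc y))" for i
      by presburger
    have Least: "L (s # xs) = m \<longleftrightarrow> ?P m \<and> (\<forall>i<m. \<not> ?P i)"
    proof
      have "?P (LEAST m. ?P m)" by (rule LeastI[of ?P s]) simp
      then show "L (s # xs) = m \<Longrightarrow> ?P m \<and> (\<forall>i<m. \<not> ?P i)"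
        using not_less_Least[of _ ?P] by (auto simp: L_def)
      show "?P m \<and> (\<forall>i<m. \<not> ?P i) \<Longrightarrow> L (s # xs) = m"
        by (auto simp: L_def not_less[symmetric] intro!: Least_equality)
    qed
    have "T (s # xs) = Suc m \<longleftrightarrow> L (s # xs) = m \<and> m < s \<and> F (s # m # xs) = 1"
      by (auto simp: T_def)
    also have "\<dots> \<longleftrightarrow> m < s \<and> F (s # m # xs) = 1 \<and> (\<forall>i<m. \<not> F (s # i # xs) \<le> 1)"
      unfolding Least by auto
    finally show ?thesis unfolding big .
  qed
  have "stages n (Mu f) T"
  proof (rule stagesI)
    have F': "total_computable (Suc (Suc n)) (\<lambda>xs. F (tl xs ! 0 # xs ! 0 # tl (tl xs)))"
      by (intro total_computable_comp[OF stagesD(1)[OF F]] computable_map_intros computable) auto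
    have "decidable_pred (Suc (Suc n))
        (\<lambda>xs. xs ! 0 = tl xs ! 0 \<or> F (tl xs ! 0 # xs ! 0 # tl (tl xs)) \<le> 1)"
      by (intro computable F') auto
    then have L: "total_computable (Suc n) L"
      unfolding L_def by (rule total_computable_Least) blast
    show "total_computable (Suc n) T"
      unfolding T_def
      by (intro computable L total_computable_comp[OF stagesD(1)[OF F]] computable_map_intros) auto
  next
    fix xs m s s' assume len: "length xs = n" and "T (s # xs) = Suc m" and s: "s \<le> s'"
    moreover have "F (s' # i # xs) = Suc y" if "F (s # i # xs) = Suc y" for i y
      using stagesD(2)[OF F that s] len by simp
    ultimately show "T (s' # xs) = Suc m"
      unfolding T by (metis One_nat_def less_le_trans)
  next
    fix xs m assume len: "length xs = n" and eval: "rec_eval (Mu f) xs m"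
    from eval have m: "rec_eval f (m # xs) 0" and "\<forall>i<m. \<exists>y. rec_eval f (i # xs) (Suc y)"
      by (cases rule: rec_eval.cases; auto)+
    then obtain y where y: "\<forall>i<m. rec_eval f (i # xs) (Suc (y i))" by metis
    have "\<exists>s. \<forall>i<m. F (s # i # xs) = Suc (Suc (y i))"
    proof (rule common_stage)
      show "\<exists>s. F (s # i # xs) = Suc (Suc (y i))" if "i < m" for i
        using stagesD(3)[OF F] y that len by simp
    qed (rule stagesD(2)[OF F], use len in simp_all)
    then obtain s where s: "\<forall>i<m. F (s # i # xs) = Suc (Suc (y i))" by blast
    obtain s' where s': "F (s' # m # xs) = Suc 0" using stagesD(3)[OF F m] len by auto
    \<comment> \<open>The stage must also exceed \<open>m\<close>, since the scan at stage
      \<open>s\<close> reports only minima below \<open>s\<close>.\<close>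
    have "T (max (Suc m) (max s s') # xs) = Suc m" (is "T (?s # xs) = _")
      unfolding T
    proof (intro conjI allI impI)
      show "F (?s # m # xs) = 1" using stagesD(2)[OF F s'] len by simp
      show "\<exists>y. F (?s # i # xs) = Suc (Suc y)" if "i < m" for i
        using stagesD(2)[OF F, of s "i # xs" _ ?s] s len that by auto
    qed simp
    then show "\<exists>s. T (s # xs) = Suc m" by blast
  next
    fix xs m s assume len: "length xs = n" and "T (s # xs) = Suc m"
    moreover have "rec_eval f (i # xs) y" if "F (s # i # xs) = Suc y" for i y
      using stagesD(4)[OF F that] len by simp
    ultimately show "rec_eval (Mu f) xs m"
      unfolding T by (intro rec_eval.Mu) (auto, blast)
  qed
  then show ?thesis by blast
qed

text \<open>The arity is generalised because the recursion schemes change it. Where the arity fits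
  no evaluation rule, the function is nowhere defined.\<close>

lemma stages_exist: "\<exists>T. stages n r T"
proof (induction r arbitrary: n)
  case Zero
  show ?case using stages_total[OF total_computable_const rec_eval.Zero] by blast
next
  case Succ
  show ?case
  proof (cases "n = 1")
    case True
    have "total_computable n (\<lambda>xs. Suc (xs ! 0))" by (intro computable) (simp add: True)
    moreover have "rec_eval Succ xs (Suc (xs ! 0))" if "length xs = n" for xs
      using that True by (cases xs) (auto intro: rec_eval.Succ)
    ultimately show ?thesis using stages_total by blast
  next
    case False
    then have "\<not> rec_eval Succ xs y" if "length xs = n" for xs y
      using that by (auto elim: rec_eval.cases)
    then show ?thesis using stages_undefined by blast
  qed
next
  case (Proj i)
  show ?case
  proof (cases "i < n")
    case True
    then show ?thesis
      using stages_total[OF total_computable_proj, of i n] rec_eval.Proj by blast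
  next
    case False
    then have "\<not> rec_eval (Proj i) xs y" if "length xs = n" for xs y
      using that by (auto elim: rec_eval.cases)
    then show ?thesis using stages_undefined by blast
  qed
next
  case (Comp f gs)
  obtain F where F: "stages (length gs) f F" using Comp.IH(1) by blast
  have "\<forall>g\<in>set gs. \<exists>T. stages n g T" using Comp.IH(2) by blast
  then obtain G where "\<And>g. g \<in> set gs \<Longrightarrow> stages n g (G g)" by (metis bchoice)
  then show ?case using stages_Comp[OF F] by blast
next
  case (PrimRec f g)
  show ?case
  proof (cases n)
    case 0
    then have "\<not> rec_eval (PrimRec f g) xs y" if "length xs = n" for xs y
      using that by (auto elim: rec_eval.cases)
    then show ?thesis using stages_undefined by blast
  next
    case (Suc m)
    then show ?thesis using PrimRec stages_PrimRec by blast
  qed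
next
  case (Mu f)
  then show ?case using stages_Mu by blast
qed

text \<open>Applied to the universal function of a numbering, this turns convergence into one
  existential quantifier over a decidable condition.\<close>

lemma partial_computable2_stages:
  assumes "partial_computable 2 (\<lambda>xs. f (xs ! 0) (xs ! 1))"
  shows "\<exists>T. total_computable 3 (\<lambda>xs. T (xs ! 0) (xs ! 1) (xs ! 2)) \<and>
    (\<forall>a b y. f a b = Some y \<longleftrightarrow> (\<exists>s. T s a b = Suc y))"
proof -
  obtain r where r: "\<And>xs y. length xs = 2 \<Longrightarrow> f (xs ! 0) (xs ! 1) = Some y \<longleftrightarrow> rec_eval r xs y"
    using assms unfolding partial_computable_def by blast
  obtain T where T: "stages 2 r T" using stages_exist by blast
  have "total_computable 3 (\<lambda>xs. T [xs ! 0, xs ! 1, xs ! 2])"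
    by (rule total_computable_cong[of _ T])
      (use stagesD(1)[OF T] in \<open>auto simp: numeral_3_eq_3 numeral_2_eq_2 length_Suc_conv\<close>)
  moreover have "f a b = Some y \<longleftrightarrow> (\<exists>s. T [s, a, b] = Suc y)" for a b y
    using r[of "[a, b]" y] stagesD(3,4)[OF T] by auto
  ultimately show ?thesis by (intro exI[of _ "\<lambda>s a b. T [s, a, b]"]) blast
qed

section \<open>Coding of pairs and sequences\<close>

lemma decidable_pred_comp3:
  assumes "decidable_pred 3 (\<lambda>xs. P (xs ! 0) (xs ! 1) (xs ! 2))"
    "total_computable n f" "total_computable n g" "total_computable n h"
  shows "decidable_pred n (\<lambda>xs. P (f xs) (g xs) (h xs))"
  using total_computable_comp3[of "\<lambda>a b c. if P a b c then 1 else 0"] assms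
  unfolding decidable_pred_def by simp

lemma decidable_pred_comp4:
  assumes "decidable_pred 4 (\<lambda>xs. P (xs ! 0) (xs ! 1) (xs ! 2) (xs ! 3))"
    "total_computable n f" "total_computable n g" "total_computable n h" "total_computable n l"
  shows "decidable_pred n (\<lambda>xs. P (f xs) (g xs) (h xs) (l xs))"
  using total_computable_comp[OF assms(1)[unfolded decidable_pred_def],
      of n "\<lambda>xs. [f xs, g xs, h xs, l xs]"] assms(2-)
  unfolding decidable_pred_def
  by (simp add: computable_map_intros eval_nat_numeral)

lemma total_computable_prod_encode [computable]:
  assumes "total_computable n f" "total_computable n g"
  shows "total_computable n (\<lambda>xs. prod_encode (f xs, g xs))"
proof -
  \<comment> \<open>\<open>prod_encode\<close> is the Cantor pairing
    \<open>triangle (a + b) + a\<close>, so it remains to compute triangular numbers.\<close>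
  have triangle: "rec_nat 0 (\<lambda>m v. v + Suc m) b = triangle b" for b
    by (induction b) auto
  have "total_computable 1 (\<lambda>xs. rec_nat 0 (\<lambda>m v. v + Suc m) (xs ! 0))"
    by (rule computable | simp)+
  then have "total_computable 1 (\<lambda>xs. triangle (xs ! 0))"
    by (simp only: triangle)
  note [computable] = total_computable_comp1[OF this]
  show ?thesis unfolding prod_encode_def by (simp, (rule computable assms)+)
qed

definition pair_fst :: "nat \<Rightarrow> nat" where
  "pair_fst z = fst (prod_decode z)"

definition pair_snd :: "nat \<Rightarrow> nat" where
  "pair_snd z = snd (prod_decode z)"

lemma pair_fst_encode [simp]: "pair_fst (prod_encode (a, b)) = a"
  and pair_snd_encode [simp]: "pair_snd (prod_encode (a, b)) = b"
  by (simp_all add: pair_fst_def pair_snd_def)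

lemma prod_encode_pair [simp]: "prod_encode (pair_fst z, pair_snd z) = z"
  by (simp add: pair_fst_def pair_snd_def)

lemma pair_le: "pair_fst z \<le> z" "pair_snd z \<le> z"
  using le_prod_encode_1[of "pair_fst z" "pair_snd z"] le_prod_encode_2[of "pair_snd z" "pair_fst z"]
  by simp_all

text \<open>The pairing is inverted by search. Components never exceed the code, which bounds the
  inner quantifier.\<close>

lemma total_computable_pair_fst [computable]:
  assumes "total_computable n f"
  shows "total_computable n (\<lambda>xs. pair_fst (f xs))"
proof (rule total_computable_comp1[OF _ assms])
  have Least: "pair_fst z = (LEAST a. \<exists>b<Suc z. prod_encode (a, b) = z)" for z
    by (rule Least_equality[symmetric]) (auto simp: less_Suc_eq_le pair_le intro: exI[of _ "pair_snd z"])
  have "total_computable 1 (\<lambda>xs. LEAST a. \<exists>b<Suc (xs ! 0). prod_encode (a, b) = xs ! 0)"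
  proof (rule total_computable_Least)
    show "decidable_pred (Suc 1)
        (\<lambda>xs. \<exists>b<Suc (tl xs ! 0). prod_encode (xs ! 0, b) = tl xs ! 0)"
      by (rule computable | simp)+
    show "\<exists>a. \<exists>b<Suc (xs ! 0). prod_encode (a, b) = xs ! 0" for xs
      by (metis le_imp_less_Suc pair_le(2) prod_encode_pair)
  qed
  then show "total_computable 1 (\<lambda>xs. pair_fst (xs ! 0))" by (simp only: Least)
qed

lemma total_computable_pair_snd [computable]:
  assumes "total_computable n f"
  shows "total_computable n (\<lambda>xs. pair_snd (f xs))"
proof (rule total_computable_comp1[OF _ assms])
  have Least: "pair_snd z = (LEAST b. prod_encode (pair_fst z, b) = z)" for z
    by (rule Least_equality[symmetric]) (simp, metis order_refl pair_snd_encode)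
  have "total_computable 1 (\<lambda>xs. LEAST b. prod_encode (pair_fst (xs ! 0), b) = xs ! 0)"
  proof (rule total_computable_Least)
    show "decidable_pred (Suc 1) (\<lambda>xs. prod_encode (pair_fst (tl xs ! 0), xs ! 0) = tl xs ! 0)"
      by (rule computable | simp)+
    show "\<exists>b. prod_encode (pair_fst (xs ! 0), b) = xs ! 0" for xs
      by (metis prod_encode_pair)
  qed
  then show "total_computable 1 (\<lambda>xs. pair_snd (xs ! 0))" by (simp only: Least)
qed

text \<open>Every number codes an infinite sequence by iterated pairing. No length is stored,
  decoding is total, and any finite initial segment can be prescribed.\<close>

primrec entry :: "nat \<Rightarrow> nat \<Rightarrow> nat" where
  "entry a 0 = pair_fst a"
| "entry a (Suc i) = entry (pair_snd a) i"

lemma total_computable_entry [computable]: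
  assumes "total_computable n f" "total_computable n g"
  shows "total_computable n (\<lambda>xs. entry (f xs) (g xs))"
proof -
  \<comment> \<open>\<open>entry\<close> changes its first argument along the recursion; moving
    \<open>pair_snd\<close> outside turns this into an iteration with fixed parameters.\<close>
  have shift: "rec_nat (pair_snd a) (\<lambda>_ v. pair_snd v) i = pair_snd (rec_nat a (\<lambda>_ v. pair_snd v) i)"
    for a i by (induction i) auto
  have "entry a i = pair_fst (rec_nat a (\<lambda>_ v. pair_snd v) i)" for a i
    by (induction i arbitrary: a) (simp_all add: shift)
  moreover have "total_computable n (\<lambda>xs. pair_fst (rec_nat (f xs) (\<lambda>_ v. pair_snd v) (g xs)))"
    by (rule computable assms | simp)+
  ultimately show ?thesis by simp
qed

lemma entries_exist: "\<exists>a. \<forall>i<N. entry a i = f i"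
proof (induction N arbitrary: f)
  case (Suc N)
  obtain a where "\<forall>i<N. entry a i = f (Suc i)" using Suc[of "\<lambda>i. f (Suc i)"] by blast
  then have "\<forall>i<Suc N. entry (prod_encode (f 0, a)) i = f i"
    by (auto simp: less_Suc_eq_0_disj)
  then show ?case by blast
qed simp

lemma entry_matrix_exists: "\<exists>a. \<forall>l<M. \<forall>i<N. entry (entry a l) i = f l i"
proof -
  have "\<forall>l. \<exists>b. \<forall>i<N. entry b i = f l i" using entries_exist by blast
  then obtain row where row: "\<forall>l. \<forall>i<N. entry (row l) i = f l i" by (rule choice[THEN exE])
  obtain a where "\<forall>l<M. entry a l = row l" using entries_exist by blast
  with row show ?thesis by (intro exI[of _ a]) simp
qed

section \<open>Computing the program length\<close>

lemma total_computable_power2 [computable]: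
  assumes "total_computable n f"
  shows "total_computable n (\<lambda>xs. 2 ^ f xs)"
proof -
  have "rec_nat 1 (\<lambda>_ v. v + v) b = (2::nat) ^ b" for b by (induction b) auto
  moreover have "total_computable n (\<lambda>xs. rec_nat 1 (\<lambda>_ v. v + v) (f xs))"
    by (rule computable assms | simp)+
  ultimately show ?thesis by simp
qed

text \<open>This makes the programs of length at most \<open>k\<close> finite in number: their
  indices lie below \<open>2 ^ Suc k\<close>.\<close>

lemma less_power_program_length: "Suc e < 2 ^ Suc (program_length e)"
  using floor_log_exp2_gt[of "Suc e"] by (simp add: program_length_def)

lemma total_computable_program_length [computable]:
  assumes "total_computable n f"
  shows "total_computable n (\<lambda>xs. program_length (f xs))"
proof (rule total_computable_comp1[OF _ assms])
  have "program_length e = (LEAST k. Suc e < 2 ^ Suc k)" for e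
  proof (rule Least_equality[symmetric])
    show "Suc e < 2 ^ Suc (program_length e)" by (rule less_power_program_length)
  next
    fix k assume "Suc e < 2 ^ Suc k"
    moreover have "2 ^ program_length e \<le> Suc e"
      using floor_log_exp2_le[of "Suc e"] by (simp add: program_length_def)
    ultimately have "(2::nat) ^ program_length e < 2 ^ Suc k" by linarith
    then show "program_length e \<le> k"
      by (metis less_Suc_eq_le one_less_numeral_iff power_less_imp_less_exp semiring_norm(76))
  qed
  moreover have "total_computable 1 (\<lambda>xs. LEAST k. Suc (xs ! 0) < 2 ^ Suc k)"
  proof (rule total_computable_Least)
    show "decidable_pred (Suc 1) (\<lambda>xs. Suc (tl xs ! 0) < 2 ^ Suc (xs ! 0))"
      by (rule computable | simp del: power_Suc)+
  qed (use less_power_program_length in blast)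
  ultimately show "total_computable 1 (\<lambda>xs. program_length (xs ! 0))" by simp
qed

section \<open>Effective open sets and Markov names\<close>

lemma acceptable_numbering_stages:
  assumes "acceptable_numbering \<phi>"
  shows "\<exists>T. total_computable 3 (\<lambda>xs. T (xs ! 0) (xs ! 1) (xs ! 2)) \<and>
    (\<forall>e m y. \<phi> e m = Some y \<longleftrightarrow> (\<exists>s. T s e m = Suc y))"
  using assms unfolding acceptable_numbering_def by (blast intro: partial_computable2_stages)

lemma acceptable_numbering_translate:
  assumes "acceptable_numbering \<phi>" "partial_computable 2 (\<lambda>xs. \<psi> (xs ! 0) (xs ! 1))"
  shows "\<exists>s. total_computable 1 (\<lambda>xs. s (xs ! 0)) \<and> (\<forall>i. \<phi> (s i) = \<psi> i)"
  using assms unfolding acceptable_numbering_def by simp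

text \<open>The set of indices \<open>y\<close> is the domain of a search for \<open>t\<close>, and
  acceptability yields an index of it computably. As the translation takes a single parameter,
  \<open>n\<close> and \<open>k\<close> are paired into \<open>z\<close>.\<close>

lemma uniformly_effective_open2I:
  assumes acceptable: "acceptable_numbering \<phi>"
    and Q: "decidable_pred 4 (\<lambda>xs. Q (xs ! 0) (xs ! 1) (xs ! 2) (xs ! 3))"
  shows "uniformly_effective_open2 \<phi> B (\<lambda>n k. \<Union>y\<in>{y. \<exists>t. Q n k y t}. B y)"
proof -
  define P where "P z y t \<longleftrightarrow> Q (pair_fst z) (pair_snd z) y t" for z y t
  define \<psi> where "\<psi> z y = (if \<exists>t. P z y t then Some (LEAST t. P z y t) else None)" for z y
  have "decidable_pred (Suc 2) (\<lambda>xs. P (tl xs ! 0) (tl xs ! 1) (xs ! 0))"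
    unfolding P_def by (rule computable decidable_pred_comp4[OF Q] | simp)+
  from partial_computable_Least[OF this]
  have "partial_computable 2 (\<lambda>xs. \<psi> (xs ! 0) (xs ! 1))"
    unfolding \<psi>_def .
  then obtain s where s: "total_computable 1 (\<lambda>xs. s (xs ! 0))" "\<And>z. \<phi> (s z) = \<psi> z"
    using acceptable_numbering_translate[OF acceptable] by blast
  have "total_computable 2 (\<lambda>xs. s (prod_encode (xs ! 0, xs ! 1)))"
    by (rule computable total_computable_comp1[OF s(1)] | simp)+
  moreover have "W \<phi> (s (prod_encode (n, k))) = {y. \<exists>t. Q n k y t}" for n k
    by (auto simp: W_def s(2) \<psi>_def P_def split: if_splits)
  ultimately show ?thesis
    unfolding uniformly_effective_open2_def effective_open_def
    by (intro exI[of _ "\<lambda>n k. s (prod_encode (n, k))"]) simp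
qed

section \<open>Markov names and points of bounded complexity\<close>

lemma ex_markov_name:
  assumes "acceptable_numbering \<phi>" "x \<in> computable_points X B"
  shows "\<exists>e. markov_name \<phi> B x e"
proof -
  obtain p where p: "total_computable 1 (\<lambda>xs. p (xs ! 0))" "type2_name B x p"
    using assms(2) unfolding computable_points_def by blast
  \<comment> \<open>The sequence of functions ignores its index, so every translated index computes
    \<open>p\<close>; \<open>s 0\<close> is an arbitrary choice.\<close>
  have "total_computable 2 (\<lambda>xs. p (xs ! 1))"
    by (rule computable total_computable_comp1[OF p(1)] | simp)+
  then obtain s :: "nat \<Rightarrow> nat" where "\<And>i. \<phi> (s i) = (\<lambda>n. Some (p n))"
    using acceptable_numbering_translate[OF assms(1), of "\<lambda>_ n. Some (p n)"]
    unfolding total_computable_def by blast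
  then have "markov_name \<phi> B x (s 0)" using p(2) unfolding markov_name_def by auto
  then show ?thesis by blast
qed

text \<open>A computable point has some Markov name, so the \<open>LEAST\<close> defining its
  complexity is attained.\<close>

lemma mem_computable_points_upto_iff:
  assumes "acceptable_numbering \<phi>"
  shows "x \<in> computable_points_upto \<phi> X B k \<longleftrightarrow>
    x \<in> computable_points X B \<and> (\<exists>e. markov_name \<phi> B x e \<and> program_length e \<le> k)"
proof -
  let ?P = "\<lambda>l. \<exists>e. markov_name \<phi> B x e \<and> program_length e = l"
  have "point_complexity \<phi> B x \<le> k \<longleftrightarrow> (\<exists>e. markov_name \<phi> B x e \<and> program_length e \<le> k)"
    if "x \<in> computable_points X B"
  proof
    assume "point_complexity \<phi> B x \<le> k"
    moreover have "?P (point_complexity \<phi> B x)"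
      unfolding point_complexity_def using ex_markov_name[OF assms that] by - (rule LeastI_ex, blast)
    ultimately show "\<exists>e. markov_name \<phi> B x e \<and> program_length e \<le> k" by auto
  next
    assume "\<exists>e. markov_name \<phi> B x e \<and> program_length e \<le> k"
    then obtain e where "markov_name \<phi> B x e" "program_length e \<le> k" by blast
    then show "point_complexity \<phi> B x \<le> k"
      unfolding point_complexity_def using Least_le[of ?P "program_length e"] by fastforce
  qed
  then show ?thesis unfolding computable_points_upto_def by blast
qed

section \<open>The equivalence\<close>

lemma ex_Sigma02_of_differences:
  assumes acceptable: "acceptable_numbering \<phi>"
    and U: "uniformly_effective_open2 \<phi> B U" and V: "uniformly_effective_open2 \<phi> B V"
    and A: "\<And>k. A \<inter> computable_points_upto \<phi> X B k =
      (\<Union>n. U n k - V n k) \<inter> computable_points_upto \<phi> X B k"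
  shows "\<exists>I. Sigma02_nat I \<and>
    (\<forall>x \<in> computable_points X B. \<forall>e. markov_name \<phi> B x e \<longrightarrow> (x \<in> A \<longleftrightarrow> e \<in> I))"
proof -
  obtain T where T: "total_computable 3 (\<lambda>xs. T (xs ! 0) (xs ! 1) (xs ! 2))"
      "\<And>a b y. \<phi> a b = Some y \<longleftrightarrow> (\<exists>s. T s a b = Suc y)"
    using acceptable_numbering_stages[OF acceptable] by blast
  obtain u where u: "total_computable 2 (\<lambda>xs. u (xs ! 0) (xs ! 1))"
      "\<And>n k. U n k = effective_open \<phi> B (u n k)"
    using U unfolding uniformly_effective_open2_def by blast
  obtain v where v: "total_computable 2 (\<lambda>xs. v (xs ! 0) (xs ! 1))"
      "\<And>n k. V n k = effective_open \<phi> B (v n k)"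
    using V unfolding uniformly_effective_open2_def by blast
  \<comment> \<open>The witness \<open>b\<close> codes a position in the name, the stage at which
    \<open>e\<close> answers there, and the stage at which the open set accepts the answer.
    Subtracting 1 strips the successor of the stage value; \<open>h\<close> stands for
    \<open>u\<close> or \<open>v\<close>.\<close>
  define hit where "hit h e n b \<longleftrightarrow> T (entry b 1) e (entry b 0) \<noteq> 0 \<and>
      T (entry b 2) (h n (program_length e)) (T (entry b 1) e (entry b 0) - 1) \<noteq> 0" 
    for h :: "nat \<Rightarrow> nat \<Rightarrow> nat" and e n b
  have hit: "x \<in> effective_open \<phi> B (h n (program_length e)) \<longleftrightarrow> (\<exists>b. hit h e n b)"
    if e: "markov_name \<phi> B x e" for h x e n
  proof -
    obtain p where p: "\<And>m. \<phi> e m = Some (p m)" "range p = {i. x \<in> B i}"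
      using e unfolding markov_name_def type2_name_def by blast
    have stage: "T s e m = Suc y \<Longrightarrow> y = p m" for s m y
      using p(1) T(2)[of e m y] by auto
    show ?thesis
    proof
      assume "x \<in> effective_open \<phi> B (h n (program_length e))"
      then obtain i z where i: "x \<in> B i" "\<phi> (h n (program_length e)) i = Some z"
        unfolding effective_open_def W_def by blast
      then obtain m where m: "i = p m" using p(2) by blast
      obtain s where s: "T s e m = Suc i" using p(1) T(2) m by blast
      obtain s' where s': "T s' (h n (program_length e)) i = Suc z" using i(2) T(2) by blast
      obtain b where b: "\<forall>l<3. entry b l = [m, s, s'] ! l" using entries_exist by blast
      have "entry b 0 = m" "entry b 1 = s" "entry b 2 = s'"
        using b[rule_format, of 0] b[rule_format, of 1] b[rule_format, of 2] by simp_all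
      then have "hit h e n b" using s s' by (simp add: hit_def)
      then show "\<exists>b. hit h e n b" by blast
    next
      assume "\<exists>b. hit h e n b"
      then obtain b where b: "hit h e n b" by blast
      obtain i where i: "T (entry b 1) e (entry b 0) = Suc i"
        using b unfolding hit_def by (auto simp: gr0_conv_Suc)
      obtain z where "T (entry b 2) (h n (program_length e)) i = Suc z"
        using b i unfolding hit_def by (auto simp: gr0_conv_Suc)
      then have "i \<in> W \<phi> (h n (program_length e))" using T(2) unfolding W_def by blast
      moreover have "x \<in> B i" using stage[OF i] p(2) by blast
      ultimately show "x \<in> effective_open \<phi> B (h n (program_length e))"
        unfolding effective_open_def by blast
    qed
  qed
  \<comment> \<open>\<open>a\<close> packs the index \<open>n\<close> with a witness for
    \<open>U\<close>; \<open>b\<close> ranges over all candidate witnesses for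
    \<open>V\<close>.\<close>
  define R where "R e a b \<longleftrightarrow> hit u e (pair_fst a) (pair_snd a) \<and> \<not> hit v e (pair_fst a) b"
    for e a b
  have "decidable_pred 3 (\<lambda>xs. R (xs ! 0) (xs ! 1) (xs ! 2))"
    unfolding R_def hit_def
    by (rule computable total_computable_comp3[OF T(1)] total_computable_comp2[OF u(1)]
        total_computable_comp2[OF v(1)] | simp)+
  then have "Sigma02_nat {e. \<exists>a. \<forall>b. R e a b}" unfolding Sigma02_nat_def by blast
  moreover have "x \<in> A \<longleftrightarrow> (\<exists>a. \<forall>b. R e a b)"
    if x: "x \<in> computable_points X B" and e: "markov_name \<phi> B x e" for x e
  proof -
    \<comment> \<open>The name \<open>e\<close> itself certifies this complexity bound, so
      \<open>program_length e\<close> serves as \<open>k\<close>.\<close>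
    have "x \<in> computable_points_upto \<phi> X B (program_length e)"
      unfolding mem_computable_points_upto_iff[OF acceptable] using x e by blast
    then have "x \<in> A \<longleftrightarrow> (\<exists>n. x \<in> U n (program_length e) \<and> x \<notin> V n (program_length e))"
      using A[of "program_length e"] by blast
    also have "\<dots> \<longleftrightarrow> (\<exists>n c. hit u e n c \<and> (\<forall>b. \<not> hit v e n b))"
      unfolding u(2) v(2) hit[OF e] by blast
    also have "\<dots> \<longleftrightarrow> (\<exists>a. \<forall>b. R e a b)"
      unfolding R_def by (metis pair_fst_encode pair_snd_encode)
    finally show ?thesis .
  qed
  ultimately show ?thesis by blast
qed

section \<open>From an arithmetical set of indices to differences\<close>

lemma ex_differences_of_Sigma02:
  assumes acceptable: "acceptable_numbering \<phi>"
    and X: "effective_topological_space \<phi> X B"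
    and "Sigma02_nat I"
    and I: "\<And>x e. x \<in> computable_points X B \<Longrightarrow> markov_name \<phi> B x e \<Longrightarrow> x \<in> A \<longleftrightarrow> e \<in> I"
  shows "\<exists>U V. uniformly_effective_open2 \<phi> B U \<and> uniformly_effective_open2 \<phi> B V \<and>
    (\<forall>k. A \<inter> computable_points_upto \<phi> X B k =
         (\<Union>n. U n k - V n k) \<inter> computable_points_upto \<phi> X B k)"
proof -
  obtain T where T: "total_computable 3 (\<lambda>xs. T (xs ! 0) (xs ! 1) (xs ! 2))"
      "\<And>a b y. \<phi> a b = Some y \<longleftrightarrow> (\<exists>s. T s a b = Suc y)"
    using acceptable_numbering_stages[OF acceptable] by blast
  obtain R where R: "decidable_pred 3 (\<lambda>xs. R (xs ! 0) (xs ! 1) (xs ! 2))"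
      "I = {e. \<exists>a. \<forall>b. R e a b}"
    using assms(3) unfolding Sigma02_nat_def by blast
  obtain g where g: "total_computable 2 (\<lambda>xs. g (xs ! 0) (xs ! 1))"
      "\<And>i j. B i \<inter> B j = (\<Union>k\<in>W \<phi> (g i j). B k)"
    using X unfolding effective_topological_space_def by blast
  have T_W: "y \<in> W \<phi> a \<longleftrightarrow> (\<exists>s. T s a y \<noteq> 0)" for a y
    using T(2)[of a y] unfolding W_def by (metis domD domI not0_implies_Suc old.nat.distinct(1))

  \<comment> \<open>\<open>c\<close> selects the guessed cause, \<open>d\<close> and \<open>i\<close> are its data; a refutation at stage \<open>t\<close> puts
    \<open>B y\<close> into \<open>V\<close>.\<close>
  define refuted where "refuted e c d i y t \<longleftrightarrow>
      (if c = 0 then T t e d \<noteq> 0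
       else if c = 1 then T t e d = Suc y
       else if c = 2 then T (pair_fst t) e (pair_snd t) = Suc i
       else \<not> R e d t)" for e c d i y t :: nat
  \<comment> \<open>For a true name outside \<open>I\<close> all four causes are false, and each
    failure shows at some stage. With \<open>c = 2\<close> this rests on \<open>x \<in> B i\<close>,
    which forces \<open>i\<close> to be listed.\<close>
  have refuted_name: "\<exists>y t. refuted e c d i y t \<and> x \<in> B y"
    if e: "markov_name \<phi> B x e" and "e \<notin> I" and i: "x \<in> B i" for x e c d i
  proof -
    obtain p where p: "\<And>m. \<phi> e m = Some (p m)" "range p = {i. x \<in> B i}"
      using e unfolding markov_name_def type2_name_def by blast
    have stage: "\<exists>s. T s e m = Suc (p m)" for m using p(1) T(2) by blast
    have x: "x \<in> B (p m)" for m using p(2) by blast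
    obtain s where s: "T s e d = Suc (p d)" using stage by blast
    obtain m where m: "i = p m" using p(2) i by blast
    obtain s' where s': "T s' e m = Suc i" using stage m by blast
    obtain b where b: "\<not> R e d b" using \<open>e \<notin> I\<close> R(2) by blast
    consider "c = 0" | "c = 1" | "c = 2" | "c \<noteq> 0" "c \<noteq> 1" "c \<noteq> 2" by blast
    then show ?thesis
    proof cases
      case 1
      \<comment> \<open>For \<open>c = 0\<close> the index \<open>y\<close> is unconstrained;
        \<open>p d\<close> is taken as the index of a basic set containing \<open>x\<close>.\<close>
      then have "refuted e c d i (p d) s" using s by (simp add: refuted_def)
      then show ?thesis using x by blast
    next
      case 2
      then have "refuted e c d i (p d) s" using s by (simp add: refuted_def)
      then show ?thesis using x by blast
    next
      case 3
      then have "refuted e c d i (p d) (prod_encode (s', m))" using s' by (simp add: refuted_def)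
      then show ?thesis using x by blast
    next
      case 4
      then have "refuted e c d i (p d) b" using b by (simp add: refuted_def)
      then show ?thesis using x by blast
    qed
  qed
  \<comment> \<open>Conversely some guess survives. \<open>U\<close> will demand
    \<open>x \<in> B i\<close> whatever the cause, so the given \<open>i\<close> serves as filler
    except when an unlisted index is the cause.\<close>
  have ex_unrefuted: "\<exists>c d i. x \<in> B i \<and> (\<forall>y t. refuted e c d i y t \<longrightarrow> x \<notin> B y)"
    if e: "markov_name \<phi> B x e \<Longrightarrow> e \<in> I" and i: "x \<in> B i" for x e i
  proof (cases "\<exists>d. \<phi> e d = None")
    case True
    then obtain d where "\<phi> e d = None" by blast
    then have "T t e d = 0" for t using T(2)[of e d "T t e d - 1"] by (cases "T t e d") auto
    then have "\<not> refuted e 0 d i y t" for y t by (simp add: refuted_def)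
    then show ?thesis using i by blast
  next
    case False
    then have "\<forall>m. \<exists>y. \<phi> e m = Some y" by auto
    then obtain p where p: "\<And>m. \<phi> e m = Some (p m)" by metis
    have stage: "T s e m = Suc y \<Longrightarrow> y = p m" for s m y
      using p T(2)[of e m y] by auto
    consider d where "x \<notin> B (p d)" | i' where "x \<in> B i'" "i' \<notin> range p" | "range p = {i. x \<in> B i}"
      by blast
    then show ?thesis
    proof cases
      case 1
      then have "refuted e 1 d i y t \<longrightarrow> x \<notin> B y" for y t
        using stage by (auto simp: refuted_def)
      then show ?thesis using i by blast
    next
      case 2
      then have "\<not> refuted e 2 d i' y t" for d y t using stage by (auto simp: refuted_def)
      then show ?thesis using 2(1) by blast
    next
      case 3
      then have "e \<in> I" using e p unfolding markov_name_def type2_name_def by blast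
      then obtain a where "\<forall>b. R e a b" using R(2) by blast
      \<comment> \<open>Any code other than 0, 1 and 2 selects the last cause; here the datum is the
        witness \<open>a\<close>.\<close>
      then have "\<not> refuted e 3 a i y t" for y t by (simp add: refuted_def)
      then show ?thesis using i by blast
    qed
  qed

  \<comment> \<open>Rows \<open>0\<close> to \<open>2\<close> of \<open>n\<close> hold the guesses \<open>c\<close>, \<open>d\<close>, \<open>i\<close>. Row \<open>4\<close> holds a chain of indices \<open>j\<close> with
    \<open>B (j (e + 1)) \<subseteq> B (j e) \<inter> B (i e)\<close>, certified by the stages in row \<open>3\<close>; its last element
    names a basic open set inside all \<open>B (i e)\<close>.\<close>
  define guess where "guess n l e = entry (entry n l) e" for n l e
  define N :: "nat \<Rightarrow> nat" where "N k = 2 ^ Suc k" for k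
  \<comment> \<open>Only the last element of the chain qualifies as \<open>y\<close>:
    \<open>U n k\<close> is that basic set if the guessed stages certify the chain, and empty
    otherwise.\<close>
  define QU where "QU n k y (t::nat) \<longleftrightarrow> y = guess n 4 (N k) \<and>
      (\<forall>e<N k. T (guess n 3 e) (g (guess n 4 e) (guess n 2 e)) (guess n 4 (Suc e)) \<noteq> 0)"
    for n k y t
  define QV where "QV n k y t \<longleftrightarrow>
      (\<exists>e<N k. refuted e (guess n 0 e) (guess n 1 e) (guess n 2 e) y t)" for n k y t
  define U where "U = (\<lambda>n k. \<Union>y\<in>{y. \<exists>t. QU n k y t}. B y)"
  define V where "V = (\<lambda>n k. \<Union>y\<in>{y. \<exists>t. QV n k y t}. B y)"
  have "decidable_pred 4 (\<lambda>xs. QU (xs ! 0) (xs ! 1) (xs ! 2) (xs ! 3))"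
    unfolding QU_def guess_def N_def
    by (rule computable total_computable_comp3[OF T(1)] total_computable_comp2[OF g(1)]
        | simp del: power_Suc)+
  then have U_open: "uniformly_effective_open2 \<phi> B U"
    unfolding U_def by (rule uniformly_effective_open2I[OF acceptable])
  have "decidable_pred 4 (\<lambda>xs. QV (xs ! 0) (xs ! 1) (xs ! 2) (xs ! 3))"
    unfolding QV_def refuted_def guess_def N_def
    by (rule computable total_computable_comp3[OF T(1)] decidable_pred_comp3[OF R(1)]
        | simp del: power_Suc)+
  then have V_open: "uniformly_effective_open2 \<phi> B V"
    unfolding V_def by (rule uniformly_effective_open2I[OF acceptable])
  have "x \<in> A \<longleftrightarrow> (\<exists>n. x \<in> U n k \<and> x \<notin> V n k)"
    if x_upto: "x \<in> computable_points_upto \<phi> X B k" for x k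
  proof -
    obtain e where x: "x \<in> computable_points X B" and e: "markov_name \<phi> B x e"
      and "program_length e \<le> k"
      using x_upto unfolding mem_computable_points_upto_iff[OF acceptable] by blast
    have "Suc e < 2 ^ Suc (program_length e)" by (rule less_power_program_length)
    also have "\<dots> \<le> N k" unfolding N_def using \<open>program_length e \<le> k\<close>
      by (intro power_increasing) auto
    finally have e_less: "e < N k" by simp
    show ?thesis
    proof
      assume "\<exists>n. x \<in> U n k \<and> x \<notin> V n k"
      then obtain n where xU: "x \<in> U n k" and xV: "x \<notin> V n k" by blast
      let ?i = "guess n 2" and ?j = "guess n 4"
      have xN: "x \<in> B (?j (N k))"
        and link: "\<And>e. e < N k \<Longrightarrow> T (guess n 3 e) (g (?j e) (?i e)) (?j (Suc e)) \<noteq> 0"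
        using xU unfolding U_def QU_def by auto
      have step: "B (?j (Suc m)) \<subseteq> B (?j m) \<inter> B (?i m)" if "m < N k" for m
        using link[OF that] g(2)[of "?j m" "?i m"] T_W by blast
      \<comment> \<open>Downward induction along the chain, since membership is given at its last
        element.\<close>
      have "x \<in> B (?j m)" if "m \<le> N k" for m
        using that xN by (induction rule: inc_induct) (use step in blast)+
      then have "x \<in> B (?i e)" using step[OF e_less] e_less by (meson IntD2 Suc_leI subsetD)
      \<comment> \<open>If \<open>e\<close> were outside \<open>I\<close>, its guess would be
        refuted and \<open>x\<close> would lie in \<open>V n k\<close>.\<close>
      then have "e \<in> I"
        using refuted_name[OF e, of "?i e" "guess n 0 e" "guess n 1 e"] xV e_less
        unfolding V_def QV_def by blast
      then show "x \<in> A" using I[OF x e] by blast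
    next
      assume "x \<in> A"
      obtain i0 where i0: "x \<in> B i0" using e unfolding markov_name_def type2_name_def by blast
      \<comment> \<open>If \<open>e\<close> names \<open>x\<close>, then \<open>x \<in> A\<close>
        gives \<open>e \<in> I\<close>; if it does not, the premise of \<open>ex_unrefuted\<close>
        is vacuous. So every \<open>e\<close> has a surviving guess.\<close>
      have "\<forall>e. \<exists>c d i. x \<in> B i \<and> (\<forall>y t. refuted e c d i y t \<longrightarrow> x \<notin> B y)"
        using ex_unrefuted[OF _ i0] I[OF x] \<open>x \<in> A\<close> by blast
      then obtain c d i where i: "\<And>e. x \<in> B (i e)"
        and unrefuted: "\<And>e y t. refuted e (c e) (d e) (i e) y t \<Longrightarrow> x \<notin> B y"
        by metis
      \<comment> \<open>The point lies in \<open>B (j m) \<inter> B (i m)\<close>, which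
        \<open>g\<close> presents as a union of basic sets; one containing \<open>x\<close> is the
        next link.\<close>
      have "\<exists>j. \<forall>m. x \<in> B (j m) \<and> j (Suc m) \<in> W \<phi> (g (j m) (i m))"
      proof (rule dependent_nat_choice)
        show "\<exists>j. x \<in> B j" using i0 by blast
        show "\<exists>j'. x \<in> B j' \<and> j' \<in> W \<phi> (g j (i m))" if "x \<in> B j" for j m
          using that i[of m] g(2)[of j "i m"] by blast
      qed
      then obtain j where j: "\<And>m. x \<in> B (j m)" "\<And>m. j (Suc m) \<in> W \<phi> (g (j m) (i m))" by blast
      then obtain s where s: "\<And>m. T (s m) (g (j m) (i m)) (j (Suc m)) \<noteq> 0"
        unfolding T_W by metis
      \<comment> \<open>The list order fixes the meaning of the rows. The chain has one more element
        than there are indices below \<open>N k\<close>, hence \<open>Suc (N k)\<close>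
        columns.\<close>
      obtain n where n: "\<forall>l<5. \<forall>e<Suc (N k). guess n l e = ([c, d, i, s, j] ! l) e"
        unfolding guess_def using entry_matrix_exists[of 5 "Suc (N k)" "\<lambda>l. [c, d, i, s, j] ! l"]
        by blast
      have n': "guess n 0 e = c e" "guess n 1 e = d e" "guess n 2 e = i e" "guess n 3 e = s e"
        "guess n 4 e = j e" if "e \<le> N k" for e
        using n[rule_format, of 0 e] n[rule_format, of 1 e] n[rule_format, of 2 e]
          n[rule_format, of 3 e] n[rule_format, of 4 e] that by simp_all
      have "QU n k (j (N k)) 0" using s by (simp add: QU_def n')
      then have "x \<in> U n k" using j(1) unfolding U_def by blast
      moreover have "x \<notin> V n k"
        unfolding V_def QV_def using unrefuted by (auto simp del: One_nat_def simp: n' dest: less_imp_le)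
      ultimately show "\<exists>n. x \<in> U n k \<and> x \<notin> V n k" by blast
    qed
  qed
  then have "A \<inter> computable_points_upto \<phi> X B k =
      (\<Union>n. U n k - V n k) \<inter> computable_points_upto \<phi> X B k" for k by blast
  then show ?thesis using U_open V_open by blast
qed

theorem mainTheorem7:
  fixes \<phi> :: "nat \<Rightarrow> nat \<Rightarrow> nat option"
    and X :: "'a topology"
    and B :: "nat \<Rightarrow> 'a set"
    and A :: "'a set"
  assumes "acceptable_numbering \<phi>"
    and "effective_topological_space \<phi> X B"
    and "Pi02_baire \<phi> (type2_names X B)"
    and "A \<subseteq> computable_points X B"
  shows "(\<exists>I. Sigma02_nat I \<and>
            (\<forall>x \<in> computable_points X B. \<forall>e. markov_name \<phi> B x e \<longrightarrow> (x \<in> A \<longleftrightarrow> e \<in> I)))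
     \<longleftrightarrow>
         (\<exists>U V. uniformly_effective_open2 \<phi> B U \<and> uniformly_effective_open2 \<phi> B V \<and>
            (\<forall>k. A \<inter> computable_points_upto \<phi> X B k =
                 (\<Union>n. U n k - V n k) \<inter> computable_points_upto \<phi> X B k))"
  (is "?index \<longleftrightarrow> ?differences")
proof
  assume ?index
  then obtain I where "Sigma02_nat I"
    "\<forall>x \<in> computable_points X B. \<forall>e. markov_name \<phi> B x e \<longrightarrow> (x \<in> A \<longleftrightarrow> e \<in> I)" by blast
  then show ?differences by (intro ex_differences_of_Sigma02[OF assms(1,2)]) simp_all
next
  assume ?differences
  then obtain U V where "uniformly_effective_open2 \<phi> B U" "uniformly_effective_open2 \<phi> B V"
    "\<forall>k. A \<inter> computable_points_upto \<phi> X B k =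
      (\<Union>n. U n k - V n k) \<inter> computable_points_upto \<phi> X B k" by blast
  then show ?index by (intro ex_Sigma02_of_differences[OF assms(1)]) simp_all
qed

end
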